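(* Let $(T(t))_{t\ge 0}$ be a bounded $C_0$-semigroup on a Banach space $X$, with generator $-A$. Assume that $\sigma(A)\cap i\mathbb{R}=\{0\}$, that $\sup_{|s|\ge\eta}\|(is+A)^{-1}\|<\infty$ for all $\eta>0$, and that $$\lim_{s\to 0}\max\left(\|s(is+A)^{-1}\|,\|s(-is+A)^{-1}\|\right)=\infty.$$ Let $$m(s)=\sup\{\|(ir+A)^{-1}\| : |r|\ge s\},\qquad s>0,$$ and let $m^{-1}$ be any right inverse for $m$. Then there exist $c>0$ and $c'>0$ such that $$\|T(t)A(I+A)^{-1}\|\ge c\,m^{-1}(c't)$$ for all sufficiently large $t$.
   Context: The generator of the semigroup is $-A$. The function $m$ is continuous and decreasing with $m(s)\to\infty$ as $s\to 0+$; a right inverse $m^{-1}$ satisfies $m(m^{-1}(t))=t$ and is defined for all sufficiently large $t$. *)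

theory Defs
  imports "HOL-Analysis.Analysis"
begin

section \<open>Complex Banach spaces\<close>

text \<open>The libraries only provide real normed spaces. A complex normed space is a real one with a
  compatible multiplication by complex scalars.\<close>

class complex_normed_vector = real_normed_vector +
  fixes scaleC :: "complex \<Rightarrow> 'a \<Rightarrow> 'a"  (infixr \<open>*\<^sub>C\<close> 75)
  assumes scaleC_add_right: "a *\<^sub>C (x + y) = a *\<^sub>C x + a *\<^sub>C y"
    and scaleC_add_left: "(a + b) *\<^sub>C x = a *\<^sub>C x + b *\<^sub>C x"
    and scaleC_scaleC: "a *\<^sub>C (b *\<^sub>C x) = (a * b) *\<^sub>C x"
    and scaleC_of_real: "complex_of_real r *\<^sub>C x = r *\<^sub>R x"
    and norm_scaleC: "norm (a *\<^sub>C x) = cmod a * norm x"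

class complex_banach = complex_normed_vector + complete_space

instantiation complex :: complex_banach
begin
definition scaleC_complex :: "complex \<Rightarrow> complex \<Rightarrow> complex" where
  "scaleC_complex a x = a * x"
instance
  by standard
    (simp_all add: scaleC_complex_def algebra_simps norm_mult scaleR_conv_of_real)
end

definition bounded_clinear :: "('a::complex_normed_vector \<Rightarrow> 'b::complex_normed_vector) \<Rightarrow> bool" where
  "bounded_clinear f \<longleftrightarrow> bounded_linear f \<and> (\<forall>a x. f (a *\<^sub>C x) = a *\<^sub>C f x)"


section \<open>Unbounded operators\<close>

text \<open>An operator with domain \<open>D\<close> is a pair of \<open>D\<close> and a total function of which only the values
  on \<open>D\<close> matter. Its inverse is \<^term>\<open>inv_into D A\<close>, which is the genuine everywhere
  defined inverse when \<open>A\<close> maps \<open>D\<close> bijectively onto the whole space.\<close>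

definition resolvent_set :: "'a::complex_normed_vector set \<Rightarrow> ('a \<Rightarrow> 'a) \<Rightarrow> complex set" where
  "resolvent_set D A =
    {z. bij_betw (\<lambda>x. z *\<^sub>C x - A x) D UNIV \<and>
        bounded_clinear (inv_into D (\<lambda>x. z *\<^sub>C x - A x))}"

definition spectrum :: "'a::complex_normed_vector set \<Rightarrow> ('a \<Rightarrow> 'a) \<Rightarrow> complex set" where
  "spectrum D A = - resolvent_set D A"

text \<open>\<open>shifted_inv D A z\<close> is $(zI + A)^{-1}$, i.e. minus the resolvent of \<open>A\<close> at \<open>-z\<close>; it is
  meaningful when \<open>-z \<in> resolvent_set D A\<close>.\<close>

definition shifted_inv ::
    "'a::complex_normed_vector set \<Rightarrow> ('a \<Rightarrow> 'a) \<Rightarrow> complex \<Rightarrow> 'a \<Rightarrow> 'a" where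
  "shifted_inv D A z = inv_into D (\<lambda>x. z *\<^sub>C x + A x)"


section \<open>Semigroups\<close>

text \<open>The values of \<open>T\<close> at negative times are irrelevant.\<close>

definition C0_semigroup :: "(real \<Rightarrow> 'a::complex_normed_vector \<Rightarrow> 'a) \<Rightarrow> bool" where
  "C0_semigroup T \<longleftrightarrow>
    (\<forall>t\<ge>0. bounded_clinear (T t)) \<and>
    (\<forall>x. T 0 x = x) \<and>
    (\<forall>s\<ge>0. \<forall>t\<ge>0. \<forall>x. T (s + t) x = T s (T t x)) \<and>
    (\<forall>x. ((\<lambda>t. T t x) \<longlongrightarrow> x) (at_right 0))"

definition bounded_semigroup :: "(real \<Rightarrow> 'a::complex_normed_vector \<Rightarrow> 'a) \<Rightarrow> bool" where
  "bounded_semigroup T \<longleftrightarrow> bdd_above ((\<lambda>t. onorm (T t)) ` {0..})"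

definition is_generator ::
    "(real \<Rightarrow> 'a::complex_normed_vector \<Rightarrow> 'a) \<Rightarrow> 'a set \<Rightarrow> ('a \<Rightarrow> 'a) \<Rightarrow> bool" where
  "is_generator T D B \<longleftrightarrow>
    D = {x. \<exists>y. ((\<lambda>h. (T h x - x) /\<^sub>R h) \<longlongrightarrow> y) (at_right 0)} \<and>
    (\<forall>x\<in>D. ((\<lambda>h. (T h x - x) /\<^sub>R h) \<longlongrightarrow> B x) (at_right 0))"

text \<open>The function $m$. The supremum is one of reals, so it is meaningful only if the set of norms is
  bounded above.\<close>

definition resolvent_sup :: "'a::complex_normed_vector set \<Rightarrow> ('a \<Rightarrow> 'a) \<Rightarrow> real \<Rightarrow> real" where
  "resolvent_sup D A s =
    (SUP r\<in>{r. \<bar>r\<bar> \<ge> s}. onorm (shifted_inv D A (\<i> * complex_of_real r)))"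

end

theory Submission
  imports Defs
begin

text \<open>
  Write \<open>f t\<close> for the norm of \<open>T t A (I + A)\<^sup>-\<^sup>1\<close> and let \<open>K\<close> bound the norms of all \<open>T t\<close>.
  The decay rate \<open>f\<close> controls the resolvent on the imaginary axis. The operators \<open>exp (- i s t) T t\<close>
  form a semigroup with generator \<open>- (i s + A)\<close>, so for \<open>x\<close> in the domain and \<open>y = (i s + A) x\<close>
  the identity
  \<open>x = exp (- i s t) T t x + (\<integral> exp (- i s \<tau>) T \<tau> y over 0 \<le> \<tau> \<le> t)\<close> gives
  \<open>norm x \<le> norm (T t x) + K t norm y\<close>. Applying \<open>T t\<close> to \<open>i s x = y - A x\<close> gives
  \<open>\<bar>s\<bar> norm (T t x) \<le> K norm y + f t norm (x + A x)\<close>, where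
  \<open>norm (x + A x) \<le> 2 norm x + norm y\<close> if \<open>\<bar>s\<bar> \<le> 1\<close>. When \<open>f t \<le> \<bar>s\<bar> / 4\<close> the term in
  \<open>norm x\<close> is absorbed into the left-hand side, and the resolvent at \<open>i s\<close> has norm at most
  \<open>C (t + 1 / \<bar>s\<bar>)\<close> with \<open>C = 2 (K + 1)\<close> (\<open>norm_le_imaginary_shift\<close>).

  Now let \<open>s = m_inv (3 C t)\<close>, so that \<open>m s = 3 C t\<close>, and suppose that \<open>f t < s / 4\<close>. The bound
  holds at every \<open>r\<close> with \<open>s \<le> \<bar>r\<bar> < 1\<close>, while the resolvent is bounded by \<open>m 1\<close> for
  \<open>\<bar>r\<bar> \<ge> 1\<close>, so \<open>m s \<le> max (m 1) (C (t + 1 / s))\<close>. The hypothesis that \<open>s\<close> times the larger of the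
  two resolvent norms tends to infinity makes \<open>1 / s\<close> harmless: for small \<open>s\<close> it yields
  \<open>s m s \<ge> 3 C\<close>, that is \<open>1 / s \<le> t\<close>. Hence \<open>3 C t \<le> max (m 1) (2 C t)\<close>, which is impossible for
  large \<open>t\<close>. So \<open>c = 1 / 4\<close> and \<open>c' = 3 C\<close> work.

  For the operator norm \<open>f t\<close> to dominate \<open>norm (T t A x) / norm (x + A x)\<close>, the inverse of
  \<open>I + A\<close> must exist and be bounded. This is the one piece of Hille--Yosida theory involved
  (\<open>shifted_inv_right_half_plane\<close>); it comes from the same integral identity over a finite time
  interval that is long enough for \<open>exp (- t) T t\<close> to be a strict contraction.
\<close>

section \<open>Complex scalars and right difference quotients\<close>

text \<open>Orbits are integrated as functions into the underlying real Banach space.\<close>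

instance complex_banach \<subseteq> banach ..

lemma bounded_bilinear_scaleC:
  "bounded_bilinear (scaleC :: complex \<Rightarrow> 'a::complex_normed_vector \<Rightarrow> 'a)"
proof
  fix a a' :: complex and b b' :: 'a and r :: real
  show "(a + a') *\<^sub>C b = a *\<^sub>C b + a' *\<^sub>C b" by (rule scaleC_add_left)
  show "a *\<^sub>C (b + b') = a *\<^sub>C b + a *\<^sub>C b'" by (rule scaleC_add_right)
  show "(r *\<^sub>R a) *\<^sub>C b = r *\<^sub>R a *\<^sub>C b"
    by (simp add: scaleR_conv_of_real scaleC_of_real flip: scaleC_scaleC)
  show "a *\<^sub>C r *\<^sub>R b = r *\<^sub>R a *\<^sub>C b"
    by (simp add: scaleC_scaleC mult.commute flip: scaleC_of_real)
  show "\<exists>K. \<forall>a (b::'a). norm (a *\<^sub>C b) \<le> norm a * norm b * K"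
    by (rule exI[of _ 1]) (simp add: norm_scaleC)
qed

interpretation scaleC: bounded_bilinear scaleC
  by (rule bounded_bilinear_scaleC)

lemma scaleC_one [simp]: "1 *\<^sub>C x = x"
  using scaleC_of_real[of 1 x] by simp

text \<open>The fundamental theorem of calculus at \<open>t\<close>, restricted to the right of \<open>t\<close> and in the shape in
  which the definition of a generator takes its limit.\<close>

lemma integral_right_difference_quotient:
  fixes f :: "real \<Rightarrow> 'a::banach"
  assumes "continuous_on {0..} f" "t \<ge> 0"
  shows "((\<lambda>h. (integral {0..t + h} f - integral {0..t} f) /\<^sub>R h) \<longlongrightarrow> f t) (at_right 0)"
proof -
  let ?F = "\<lambda>u. integral {0..u} f"
  have "(?F has_vector_derivative f t) (at t within {0..t + 1})"
    by (rule integral_has_vector_derivative)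
       (use assms in \<open>auto intro: continuous_on_subset\<close>)
  then have "(?F has_vector_derivative f t) (at t within {t..t + 1})"
    by (rule has_vector_derivative_within_subset) (use assms in auto)
  then have lim: "((\<lambda>y. norm (?F y - ?F t - (y - t) *\<^sub>R f t) / norm (y - t)) \<longlongrightarrow> 0) (at_right t)"
    unfolding has_vector_derivative_def has_derivative_iff_norm
    by (simp add: at_within_Icc_at_right)
  have "((\<lambda>y. norm ((?F y - ?F t) /\<^sub>R (y - t) - f t)) \<longlongrightarrow> 0) (at_right t)"
  proof (rule Lim_transform_eventually[OF lim])
    show "\<forall>\<^sub>F y in at_right t. norm (?F y - ?F t - (y - t) *\<^sub>R f t) / norm (y - t) =
        norm ((?F y - ?F t) /\<^sub>R (y - t) - f t)"
    proof (rule eventually_mono[OF eventually_at_right_less])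
      fix y assume "t < y"
      then have "(?F y - ?F t) /\<^sub>R (y - t) - f t = (?F y - ?F t - (y - t) *\<^sub>R f t) /\<^sub>R (y - t)"
        by (simp add: scaleR_diff_right)
      then show "norm (?F y - ?F t - (y - t) *\<^sub>R f t) / norm (y - t) =
          norm ((?F y - ?F t) /\<^sub>R (y - t) - f t)"
        by (simp add: divide_inverse_commute)
    qed
  qed
  then have "((\<lambda>y. (?F y - ?F t) /\<^sub>R (y - t)) \<longlongrightarrow> f t) (at_right t)"
    using LIM_zero_cancel tendsto_norm_zero_iff by blast
  then show ?thesis
    by (subst (asm) filterlim_at_right_to_0) (simp add: add.commute)
qed

section \<open>Bounded semigroups and their generators\<close>

text \<open>A locale, because the same facts are needed for \<open>T\<close> and for its rescalings
  \<open>exp (- z t) T t\<close>, with one common bound \<open>K\<close>.\<close>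

locale bounded_C0_semigroup =
  fixes U :: "real \<Rightarrow> 'a::complex_banach \<Rightarrow> 'a" and D :: "'a set" and B :: "'a \<Rightarrow> 'a"
    and K :: real
  assumes C0: "C0_semigroup U"
    and generator: "is_generator U D B"
    and norm_le: "\<And>t x. t \<ge> 0 \<Longrightarrow> norm (U t x) \<le> K * norm x"
begin

lemma U_linear: "t \<ge> 0 \<Longrightarrow> bounded_linear (U t)"
  using C0 by (auto simp: C0_semigroup_def bounded_clinear_def)

lemma U_0 [simp]: "U 0 x = x"
  using C0 by (auto simp: C0_semigroup_def)

lemma U_add: "s \<ge> 0 \<Longrightarrow> t \<ge> 0 \<Longrightarrow> U (s + t) x = U s (U t x)"
  using C0 by (auto simp: C0_semigroup_def)

lemma U_tendsto: "((\<lambda>t. U t x) \<longlongrightarrow> x) (at_right 0)"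
  using C0 by (auto simp: C0_semigroup_def)

lemma U_diff: "t \<ge> 0 \<Longrightarrow> U t (x - y) = U t x - U t y"
  by (intro linear_diff bounded_linear.linear U_linear)

text \<open>Factoring out \<open>U\<close> at the earlier of the two times leaves an increment at time zero. This is what
  turns right continuity at zero into two-sided continuity of the orbits.\<close>

lemma norm_diff_le:
  assumes "s \<ge> 0" "t \<ge> 0"
  shows "norm (U t x - U s x) \<le> K * norm (U \<bar>t - s\<bar> x - x)"
proof -
  have *: "norm (U b x - U a x) \<le> K * norm (U (b - a) x - x)" if "0 \<le> a" "a \<le> b" for a b
  proof -
    have "U b x - U a x = U a (U (b - a) x - x)"
      using that by (simp add: U_diff flip: U_add)
    with norm_le[OF that(1)] show ?thesis by simp
  qed
  show ?thesis
    using *[of s t] *[of t s] assms by (cases "s \<le> t") (auto simp: norm_minus_commute)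
qed

lemma continuous_on_orbit: "continuous_on {0..} (\<lambda>t. U t x)"
  unfolding continuous_on_def
proof
  fix s :: real assume s: "s \<in> {0..}"
  have "((\<lambda>h. U \<bar>h\<bar> x) \<longlongrightarrow> x) (at_right 0)"
    by (rule Lim_transform_eventually[OF U_tendsto[of x]])
       (use eventually_at_right_less[of "0::real"] in eventually_elim, simp)
  then have "((\<lambda>h. U \<bar>h\<bar> x) \<longlongrightarrow> x) (at 0)"
    by (simp add: filterlim_at_split filterlim_at_left_to_right)
  then have "((\<lambda>t. U \<bar>t - s\<bar> x) \<longlongrightarrow> x) (at s)"
    by - (rule LIM_offset_zero_cancel, simp)
  then have "((\<lambda>t. U \<bar>t - s\<bar> x) \<longlongrightarrow> x) (at s within {0..})"
    by (rule tendsto_within_subset) simp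
  then have "((\<lambda>t. K * norm (U \<bar>t - s\<bar> x - x)) \<longlongrightarrow> 0) (at s within {0..})"
    by (intro tendsto_mult_right_zero tendsto_norm_zero LIM_zero)
  moreover have "\<forall>\<^sub>F t in at s within {0..}. norm (U t x - U s x) \<le> K * norm (U \<bar>t - s\<bar> x - x)"
    using norm_diff_le s by (auto simp: eventually_at_filter)
  ultimately have "((\<lambda>t. U t x - U s x) \<longlongrightarrow> 0) (at s within {0..})"
    by (rule Lim_null_comparison[rotated])
  then show "((\<lambda>t. U t x) \<longlongrightarrow> U s x) (at s within {0..})"
    by (rule LIM_zero_cancel)
qed

lemma orbit_integrable: "0 \<le> a \<Longrightarrow> (\<lambda>\<tau>. U \<tau> x) integrable_on {a..b}"
  by (intro integrable_continuous_real continuous_on_subset[OF continuous_on_orbit]) auto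

lemma norm_orbit_integral_le:
  assumes "0 \<le> t"
  shows "norm (integral {0..t} (\<lambda>\<tau>. U \<tau> x)) \<le> K * norm x * t"
  using integral_bound[of 0 t "\<lambda>\<tau>. U \<tau> x" "K * norm x"] assms norm_le
    continuous_on_subset[OF continuous_on_orbit[of x], of "{0..t}"] by auto

lemma bounded_linear_orbit_integral:
  assumes "0 \<le> t"
  shows "bounded_linear (\<lambda>x. integral {0..t} (\<lambda>\<tau>. U \<tau> x))"
proof (rule bounded_linear_intro[where K = "K * t"])
  have lin: "linear (U \<tau>)" if "\<tau> \<in> {0..t}" for \<tau>
    using that U_linear bounded_linear.linear by auto
  fix x y and r :: real
  show "integral {0..t} (\<lambda>\<tau>. U \<tau> (x + y)) =
      integral {0..t} (\<lambda>\<tau>. U \<tau> x) + integral {0..t} (\<lambda>\<tau>. U \<tau> y)"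
    by (subst integral_add[symmetric])
       (auto simp: orbit_integrable linear_add[OF lin] intro!: integral_cong)
  show "integral {0..t} (\<lambda>\<tau>. U \<tau> (r *\<^sub>R x)) = r *\<^sub>R integral {0..t} (\<lambda>\<tau>. U \<tau> x)"
    using integral_cong[of "{0..t}" "\<lambda>\<tau>. U \<tau> (r *\<^sub>R x)" "\<lambda>\<tau>. r *\<^sub>R U \<tau> x"]
    by (simp add: linear_scale[OF lin])
  show "norm (integral {0..t} (\<lambda>\<tau>. U \<tau> x)) \<le> norm x * (K * t)"
    using norm_orbit_integral_le[OF assms, of x] by (simp add: mult_ac)
qed

text \<open>Pulling \<open>U h\<close> under the integral can be read in two ways: the semigroup commutes with the
  integral operator, and it translates the domain of integration by \<open>h\<close>. The two readings
  compute the same difference quotient differently, and comparing the limits yields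
  \<open>orbit_integral_generator\<close>.\<close>

lemma U_orbit_integral:
  assumes "0 \<le> t" "0 \<le> h"
  shows "U h (integral {0..t} (\<lambda>\<tau>. U \<tau> x)) = integral {0..t} (\<lambda>\<tau>. U \<tau> (U h x))"
    and "U h (integral {0..t} (\<lambda>\<tau>. U \<tau> x)) =
      integral {0..t + h} (\<lambda>\<tau>. U \<tau> x) - integral {0..h} (\<lambda>\<tau>. U \<tau> x)"
proof -
  have "integral {0..t} (U h \<circ> (\<lambda>\<tau>. U \<tau> x)) = U h (integral {0..t} (\<lambda>\<tau>. U \<tau> x))"
    by (rule integral_linear[OF orbit_integrable U_linear]) (use assms in auto)
  then have 1: "U h (integral {0..t} (\<lambda>\<tau>. U \<tau> x)) = integral {0..t} (\<lambda>\<tau>. U h (U \<tau> x))"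
    by (simp add: o_def)
  also have "\<dots> = integral {0..t} (\<lambda>\<tau>. U \<tau> (U h x))"
    by (rule integral_cong) (use assms in \<open>simp flip: U_add add: add.commute\<close>)
  finally show "U h (integral {0..t} (\<lambda>\<tau>. U \<tau> x)) = integral {0..t} (\<lambda>\<tau>. U \<tau> (U h x))" .
  have "integral {0..t} (\<lambda>\<tau>. U h (U \<tau> x)) = integral {0..t} ((\<lambda>\<tau>. U \<tau> x) \<circ> (+) h)"
    by (rule integral_cong) (use assms in \<open>simp add: U_add\<close>)
  also have "\<dots> = integral {h..t + h} (\<lambda>\<tau>. U \<tau> x)"
    using integral_shift_Icc_real[of 0 t "\<lambda>\<tau>. U \<tau> x" h] by simp
  also have "\<dots> = integral {0..t + h} (\<lambda>\<tau>. U \<tau> x) - integral {0..h} (\<lambda>\<tau>. U \<tau> x)"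
    using Henstock_Kurzweil_Integration.integral_combine[OF _ _ orbit_integrable[of 0 x "t + h"], of h]
      assms by (simp add: algebra_simps)
  finally show "U h (integral {0..t} (\<lambda>\<tau>. U \<tau> x)) =
      integral {0..t + h} (\<lambda>\<tau>. U \<tau> x) - integral {0..h} (\<lambda>\<tau>. U \<tau> x)"
    using 1 by simp
qed

lemma generatorD: "x \<in> D \<Longrightarrow> ((\<lambda>h. (U h x - x) /\<^sub>R h) \<longlongrightarrow> B x) (at_right 0)"
  using generator by (auto simp: is_generator_def)

lemma generatorI:
  assumes "((\<lambda>h. (U h x - x) /\<^sub>R h) \<longlongrightarrow> y) (at_right 0)"
  shows "x \<in> D" "B x = y"
proof -
  show "x \<in> D" using assms generator by (auto simp: is_generator_def)
  from generatorD[OF this] assms show "B x = y"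
    by (intro tendsto_unique) auto
qed

lemma generator_add:
  assumes "x \<in> D" "y \<in> D"
  shows "x + y \<in> D" "B (x + y) = B x + B y"
proof -
  have "((\<lambda>h. (U h (x + y) - (x + y)) /\<^sub>R h) \<longlongrightarrow> B x + B y) (at_right 0)"
  proof (rule Lim_transform_eventually[OF tendsto_add[OF generatorD generatorD]])
    show "\<forall>\<^sub>F h in at_right 0. (U h x - x) /\<^sub>R h + (U h y - y) /\<^sub>R h = (U h (x + y) - (x + y)) /\<^sub>R h"
      using eventually_at_right_less[of 0]
      by eventually_elim
         (simp add: linear_add[OF bounded_linear.linear[OF U_linear]] algebra_simps)
  qed (use assms in auto)
  from generatorI[OF this] show "x + y \<in> D" "B (x + y) = B x + B y" by auto
qed

lemma generator_scaleR:
  assumes "x \<in> D"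
  shows "r *\<^sub>R x \<in> D" "B (r *\<^sub>R x) = r *\<^sub>R B x"
proof -
  have "((\<lambda>h. (U h (r *\<^sub>R x) - r *\<^sub>R x) /\<^sub>R h) \<longlongrightarrow> r *\<^sub>R B x) (at_right 0)"
  proof (rule Lim_transform_eventually[OF tendsto_scaleR[OF tendsto_const generatorD]])
    show "\<forall>\<^sub>F h in at_right 0. r *\<^sub>R ((U h x - x) /\<^sub>R h) = (U h (r *\<^sub>R x) - r *\<^sub>R x) /\<^sub>R h"
      using eventually_at_right_less[of 0]
      by eventually_elim
         (simp add: linear_scale[OF bounded_linear.linear[OF U_linear]] algebra_simps)
  qed (use assms in auto)
  from generatorI[OF this] show "r *\<^sub>R x \<in> D" "B (r *\<^sub>R x) = r *\<^sub>R B x" by auto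
qed

text \<open>After translation only the two end pieces of the interval survive, and each contributes the
  integrand at its end point.\<close>

lemma orbit_integral_quotient:
  assumes "0 \<le> t"
  shows "((\<lambda>h. (U h (integral {0..t} (\<lambda>\<tau>. U \<tau> x)) - integral {0..t} (\<lambda>\<tau>. U \<tau> x)) /\<^sub>R h)
    \<longlongrightarrow> U t x - x) (at_right 0)"
proof -
  let ?F = "\<lambda>u. integral {0..u} (\<lambda>\<tau>. U \<tau> x)"
  have lim: "((\<lambda>h. (?F (t + h) - ?F t) /\<^sub>R h - (?F (0 + h) - ?F 0) /\<^sub>R h) \<longlongrightarrow> U t x - U 0 x) (at_right 0)"
    by (intro tendsto_diff integral_right_difference_quotient continuous_on_orbit) (use assms in auto)
  have "((\<lambda>h. (U h (?F t) - ?F t) /\<^sub>R h) \<longlongrightarrow> U t x - U 0 x) (at_right 0)"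
  proof (rule Lim_transform_eventually[OF lim])
    show "\<forall>\<^sub>F h in at_right 0. (?F (t + h) - ?F t) /\<^sub>R h - (?F (0 + h) - ?F 0) /\<^sub>R h =
        (U h (?F t) - ?F t) /\<^sub>R h"
      using eventually_at_right_less[of 0]
      by eventually_elim (simp add: U_orbit_integral(2)[OF assms] scaleR_diff_right)
  qed
  then show ?thesis by simp
qed

lemma orbit_integral_in_D:
  assumes "0 \<le> t"
  shows "integral {0..t} (\<lambda>\<tau>. U \<tau> x) \<in> D" "B (integral {0..t} (\<lambda>\<tau>. U \<tau> x)) = U t x - x"
  using generatorI[OF orbit_integral_quotient[OF assms]] by auto

text \<open>The two-sided derivative of an orbit is avoided: the bounded integral operator is applied to
  the one-sided limit that defines \<open>B x\<close>, and the result is compared with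
  \<open>orbit_integral_quotient\<close>.\<close>

lemma orbit_integral_generator:
  assumes "x \<in> D" "0 \<le> t"
  shows "integral {0..t} (\<lambda>\<tau>. U \<tau> (B x)) = U t x - x"
proof -
  let ?J = "\<lambda>x. integral {0..t} (\<lambda>\<tau>. U \<tau> x)"
  have J: "bounded_linear ?J" by (rule bounded_linear_orbit_integral[OF assms(2)])
  have "((\<lambda>h. ?J ((U h x - x) /\<^sub>R h)) \<longlongrightarrow> ?J (B x)) (at_right 0)"
    by (rule bounded_linear.tendsto[OF J generatorD[OF assms(1)]])
  moreover have "\<forall>\<^sub>F h in at_right 0. ?J ((U h x - x) /\<^sub>R h) = (U h (?J x) - ?J x) /\<^sub>R h"
    using eventually_at_right_less[of 0]
  proof eventually_elim
    case (elim h)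
    have "?J ((U h x - x) /\<^sub>R h) = (?J (U h x) - ?J x) /\<^sub>R h"
      using linear_scale[OF bounded_linear.linear[OF J]] linear_diff[OF bounded_linear.linear[OF J]]
      by simp
    then show ?case using U_orbit_integral(1)[of t h x] elim assms by simp
  qed
  ultimately have "((\<lambda>h. (U h (?J x) - ?J x) /\<^sub>R h) \<longlongrightarrow> ?J (B x)) (at_right 0)"
    by (rule Lim_transform_eventually)
  then show ?thesis
    using orbit_integral_quotient[OF assms(2), of x] by (intro tendsto_unique) auto
qed

text \<open>The lower bound for \<open>B\<close> that drives everything: \<open>x\<close> can only be large compared with \<open>B x\<close> if its
  orbit is still large at time \<open>t\<close>.\<close>

lemma norm_le_orbit_generator:
  assumes "x \<in> D" "0 \<le> t"
  shows "norm x \<le> norm (U t x) + K * t * norm (B x)"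
proof -
  have "norm x = norm (U t x - integral {0..t} (\<lambda>\<tau>. U \<tau> (B x)))"
    by (simp add: orbit_integral_generator[OF assms])
  also have "\<dots> \<le> norm (U t x) + norm (integral {0..t} (\<lambda>\<tau>. U \<tau> (B x)))"
    by (rule norm_triangle_ineq4)
  finally show ?thesis using norm_orbit_integral_le[OF assms(2), of "B x"] by (simp add: mult_ac)
qed

text \<open>If one operator \<open>U t\<close> is a strict contraction, then \<open>U t - I\<close> is invertible. Since \<open>U t w - w\<close>
  is the value of \<open>B\<close> at the integral of the orbit of \<open>w\<close>, this makes \<open>B\<close> surjective; the lower
  bound \<open>norm_le_orbit_generator\<close> gives injectivity and the bound for the inverse.\<close>

lemma generator_bij_if_contractive:
  assumes t: "0 \<le> t" and q: "0 \<le> q" "q < 1" and le: "\<And>x. norm (U t x) \<le> q * norm x"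
  shows "bij_betw B D UNIV" "bounded_linear (inv_into D B)"
proof -
  have lower: "(1 - q) * norm x \<le> K * t * norm (B x)" if "x \<in> D" for x
    using norm_le_orbit_generator[OF that t] le[of x] by (simp add: algebra_simps)
  have "inj_on B D"
  proof (rule inj_onI)
    fix x y assume xy: "x \<in> D" "y \<in> D" "B x = B y"
    have m: "x + (- 1) *\<^sub>R y \<in> D" "B (x + (- 1) *\<^sub>R y) = 0"
      using generator_add[OF xy(1) generator_scaleR(1)[OF xy(2), of "-1"]]
        generator_scaleR(2)[OF xy(2), of "-1"] xy(3) by auto
    show "x = y" using lower[OF m(1)] m(2) q by (simp add: mult_le_0_iff)
  qed
  moreover have "\<exists>x\<in>D. B x = y" for y
  proof -
    \<comment> \<open>The fixed point equation is \<open>U t w - w = y\<close>.\<close>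
    have "\<exists>!w. U t w - y = w"
    proof (rule banach_fix_type[OF q], intro allI)
      fix v w
      show "dist (U t v - y) (U t w - y) \<le> q * dist v w"
        using le[of "v - w"] t by (simp add: dist_norm U_diff)
    qed
    then obtain w where "U t w - y = w" by blast
    then have "U t w - w = y" by (simp add: algebra_simps)
    with orbit_integral_in_D[OF t, of w] show ?thesis by auto
  qed
  ultimately show bij: "bij_betw B D UNIV" by (metis bij_betw_def UNIV_eq_I image_iff)
  let ?R = "inv_into D B"
  have R: "?R y \<in> D" "B (?R y) = y" for y
    using bij by (auto simp: bij_betw_def inv_into_into f_inv_into_f)
  have Req: "?R y = x" if "x \<in> D" "B x = y" for x y
    using that \<open>inj_on B D\<close> by auto
  show "bounded_linear ?R"
  proof (rule bounded_linear_intro[where K = "K * t / (1 - q)"])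
    show "?R (x + y) = ?R x + ?R y" for x y
      using R generator_add by (intro Req) auto
    show "?R (r *\<^sub>R x) = r *\<^sub>R ?R x" for r x
      using R generator_scaleR by (intro Req) auto
    show "norm (?R y) \<le> norm y * (K * t / (1 - q))" for y
      using lower[OF R(1)[of y]] R(2)[of y] q by (simp add: field_simps)
  qed
qed

end

section \<open>Rescaled semigroups and the resolvent\<close>

text \<open>The product rule at time zero. It is stated for an arbitrary \<open>u\<close> and every complex \<open>z\<close>, so that it
  also undoes the rescaling, with \<open>- z\<close> in place of \<open>z\<close>; this shows that rescaling leaves the
  domain of the generator unchanged.\<close>

lemma rescaled_difference_quotient:
  fixes u :: "real \<Rightarrow> 'a::complex_normed_vector"
  assumes "((\<lambda>h. (u h - x) /\<^sub>R h) \<longlongrightarrow> y) (at_right 0)"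
  shows "((\<lambda>h. (exp (- (z * complex_of_real h)) *\<^sub>C u h - x) /\<^sub>R h) \<longlongrightarrow> y - z *\<^sub>C x) (at_right 0)"
proof -
  let ?e = "\<lambda>h::real. exp (- (z * complex_of_real h))"
  have "((\<lambda>w. exp (- (z * w))) has_field_derivative - z) (at 0)"
    by (auto intro!: derivative_eq_intros)
  then have "((\<lambda>w. (exp (- (z * w)) - 1) / w) \<longlongrightarrow> - z) (at 0)"
    by (simp add: has_field_derivative_iff)
  moreover have "filterlim complex_of_real (at 0) (at_right 0)"
    unfolding filterlim_at
    using eventually_at_right_less[of "0::real"]
    by (auto intro!: tendsto_eq_intros elim: eventually_mono)
  ultimately have "((\<lambda>h. (?e h - 1) / complex_of_real h) \<longlongrightarrow> - z) (at_right 0)"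
    by (rule filterlim_compose)
  then have e: "((\<lambda>h. (?e h - 1) /\<^sub>R h) \<longlongrightarrow> - z) (at_right 0)"
    by (simp add: scaleR_conv_of_real divide_inverse_commute)
  have e1: "(?e \<longlongrightarrow> 1) (at_right 0)"
    by (auto intro!: tendsto_eq_intros)
  have lim: "((\<lambda>h. ?e h *\<^sub>C ((u h - x) /\<^sub>R h) + ((?e h - 1) /\<^sub>R h) *\<^sub>C x) \<longlongrightarrow> 1 *\<^sub>C y + (- z) *\<^sub>C x)
      (at_right 0)"
    by (intro tendsto_add scaleC.tendsto e e1 assms tendsto_const)
  have "?e h *\<^sub>C ((u h - x) /\<^sub>R h) + ((?e h - 1) /\<^sub>R h) *\<^sub>C x = (?e h *\<^sub>C u h - x) /\<^sub>R h" for h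
    by (simp add: scaleC.scaleR_right scaleC.scaleR_left scaleC.diff_left scaleC.diff_right
        scaleR_diff_right)
  then show ?thesis using lim by (simp add: scaleC.minus_left)
qed

lemma bounded_C0_semigroup_rescale:
  assumes "bounded_C0_semigroup T D B K" "Re z \<ge> 0"
  shows "bounded_C0_semigroup (\<lambda>t x. exp (- (z * complex_of_real t)) *\<^sub>C T t x) D
    (\<lambda>x. B x - z *\<^sub>C x) K"
proof -
  interpret bounded_C0_semigroup T D B K by fact
  let ?e = "\<lambda>h::real. exp (- (z * complex_of_real h))"
  let ?U = "\<lambda>t x. ?e t *\<^sub>C T t x"
  have lin: "T t (a *\<^sub>C x) = a *\<^sub>C T t x" if "t \<ge> 0" for t a x
    using C0 that by (auto simp: C0_semigroup_def bounded_clinear_def)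
  have e_inv: "exp (- (- z * complex_of_real h)) * ?e h = 1" for h
    by (simp flip: exp_add)
  show ?thesis
  proof
    show "C0_semigroup ?U"
      unfolding C0_semigroup_def bounded_clinear_def
    proof (intro conjI allI impI)
      fix t s :: real and a x assume "0 \<le> t"
      show "bounded_linear (?U t)"
        by (rule bounded_linear_compose[OF scaleC.bounded_linear_right U_linear[OF \<open>0 \<le> t\<close>]])
      show "?U t (a *\<^sub>C x) = a *\<^sub>C ?U t x"
        by (simp add: lin \<open>0 \<le> t\<close> scaleC_scaleC mult.commute)
      assume "0 \<le> s"
      have "?e (s + t) = ?e s * ?e t" by (simp add: algebra_simps flip: exp_add)
      then show "?U (s + t) x = ?U s (?U t x)"
        by (simp add: U_add lin \<open>0 \<le> t\<close> \<open>0 \<le> s\<close> scaleC_scaleC)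
    next
      fix x
      show "?U 0 x = x" by simp
      have "((\<lambda>t. ?U t x) \<longlongrightarrow> 1 *\<^sub>C x) (at_right 0)"
        by (intro scaleC.tendsto U_tendsto) (auto intro!: tendsto_eq_intros)
      then show "((\<lambda>t. ?U t x) \<longlongrightarrow> x) (at_right 0)" by simp
    qed
  next
    have fwd: "((\<lambda>h. (?U h x - x) /\<^sub>R h) \<longlongrightarrow> y - z *\<^sub>C x) (at_right 0)"
      if "((\<lambda>h. (T h x - x) /\<^sub>R h) \<longlongrightarrow> y) (at_right 0)" for x y
      using rescaled_difference_quotient[OF that] .
    have bwd: "((\<lambda>h. (T h x - x) /\<^sub>R h) \<longlongrightarrow> y - (- z) *\<^sub>C x) (at_right 0)"
      if "((\<lambda>h. (?U h x - x) /\<^sub>R h) \<longlongrightarrow> y) (at_right 0)" for x y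
      using rescaled_difference_quotient[OF that, of "- z"]
      by (simp only: scaleC_scaleC e_inv scaleC_one)
    show "is_generator ?U D (\<lambda>x. B x - z *\<^sub>C x)"
      using generator fwd bwd unfolding is_generator_def by blast
  next
    fix t x assume "0 \<le> (t::real)"
    then have "cmod (?e t) \<le> 1" using assms(2) by simp
    then have "norm (?U t x) \<le> norm (T t x)" by (simp add: norm_scaleC mult_left_le_one_le)
    also have "\<dots> \<le> K * norm x" by (rule norm_le[OF \<open>0 \<le> t\<close>])
    finally show "norm (?U t x) \<le> K * norm x" .
  qed
qed

text \<open>The resolvent set speaks of \<open>z - A\<close>, the shifted inverse of \<open>z + A\<close>, and the generator is \<open>- A\<close>.
  The signs are reconciled here.\<close>

lemma inverse_of_uminus:
  fixes f :: "'a::real_normed_vector \<Rightarrow> 'b::real_normed_vector" and D :: "'a set"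
  assumes "bij_betw (\<lambda>x. - f x) D UNIV" "bounded_linear (inv_into D (\<lambda>x. - f x))"
  shows "bij_betw f D UNIV" "bounded_linear (inv_into D f)"
proof -
  have "bij_betw (uminus \<circ> (\<lambda>x. - f x)) D UNIV"
    by (rule bij_betw_trans[OF assms(1)]) (rule bij_uminus)
  then show bij: "bij_betw f D UNIV" by (simp add: o_def)
  have "inv_into D f y = inv_into D (\<lambda>x. - f x) (- y)" for y
  proof (rule inv_into_f_eq)
    show "inj_on f D" using bij by (rule bij_betw_imp_inj_on)
    show "inv_into D (\<lambda>x. - f x) (- y) \<in> D"
      using assms(1) by (metis UNIV_I bij_betw_def inv_into_into)
    have "- f (inv_into D (\<lambda>x. - f x) (- y)) = - y"
      using assms(1) by (intro f_inv_into_f) (auto simp: bij_betw_def)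
    then show "f (inv_into D (\<lambda>x. - f x) (- y)) = y" by simp
  qed
  then have "inv_into D f = (\<lambda>y. inv_into D (\<lambda>x. - f x) (- y))" by auto
  then show "bounded_linear (inv_into D f)"
    using bounded_linear_compose[OF assms(2) bounded_linear_minus[OF bounded_linear_ident]] by simp
qed

lemma shifted_inv_if_resolvent:
  assumes "- z \<in> resolvent_set D A"
  shows "bij_betw (\<lambda>x. z *\<^sub>C x + A x) D UNIV" "bounded_linear (shifted_inv D A z)"
proof -
  have "bij_betw (\<lambda>x. - (z *\<^sub>C x + A x)) D UNIV"
    "bounded_linear (inv_into D (\<lambda>x. - (z *\<^sub>C x + A x)))"
    using assms by (auto simp: resolvent_set_def bounded_clinear_def scaleC.minus_left)
  from inverse_of_uminus[OF this]
  show "bij_betw (\<lambda>x. z *\<^sub>C x + A x) D UNIV" "bounded_linear (shifted_inv D A z)"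
    by (simp_all add: shifted_inv_def)
qed

text \<open>Rescaling by \<open>exp (- z t)\<close> turns the bounded semigroup into an exponentially decaying one, which
  is a strict contraction from some time on.\<close>

lemma shifted_inv_right_half_plane:
  assumes "bounded_C0_semigroup T D (\<lambda>x. - A x) K" "Re z > 0"
  shows "bij_betw (\<lambda>x. z *\<^sub>C x + A x) D UNIV" "bounded_linear (shifted_inv D A z)"
proof -
  interpret S: bounded_C0_semigroup "\<lambda>t x. exp (- (z * complex_of_real t)) *\<^sub>C T t x" D
    "\<lambda>x. - A x - z *\<^sub>C x" K
    using bounded_C0_semigroup_rescale[OF assms(1), of z] assms(2) by simp
  interpret T: bounded_C0_semigroup T D "\<lambda>x. - A x" K by fact
  \<comment> \<open>With this \<open>t\<close> the damping factor is \<open>exp (- max K 0)\<close>, and \<open>u < exp u\<close> for every real \<open>u\<close>.\<close>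
  define t where "t = max K 0 / Re z"
  have t: "t \<ge> 0" using assms(2) by (simp add: t_def)
  define q where "q = exp (- (Re z * t)) * max K 0"
  have "max K 0 < exp (max K 0)" using exp_ge_add_one_self[of "max K 0"] by linarith
  then have q: "0 \<le> q" "q < 1" using assms(2) by (auto simp: q_def t_def exp_minus field_simps)
  have le: "norm (exp (- (z * complex_of_real t)) *\<^sub>C T t x) \<le> q * norm x" for x
  proof -
    have "norm (T t x) \<le> max K 0 * norm x"
      by (rule order_trans[OF T.norm_le[OF t]]) (simp add: mult_right_mono)
    then show ?thesis by (simp add: norm_scaleC q_def mult.assoc mult_left_mono)
  qed
  have eq: "(\<lambda>x. - A x - z *\<^sub>C x) = (\<lambda>x. - (z *\<^sub>C x + A x))" by (simp add: algebra_simps)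
  from inverse_of_uminus[OF S.generator_bij_if_contractive[OF t q le, unfolded eq]]
  show "bij_betw (\<lambda>x. z *\<^sub>C x + A x) D UNIV" "bounded_linear (shifted_inv D A z)"
    by (simp_all add: shifted_inv_def)
qed

lemma shifted_inv_in_D:
  assumes "bij_betw (\<lambda>x. z *\<^sub>C x + A x) D UNIV"
  shows "shifted_inv D A z y \<in> D"
    and "z *\<^sub>C shifted_inv D A z y + A (shifted_inv D A z y) = y"
proof -
  have im: "y \<in> (\<lambda>x. z *\<^sub>C x + A x) ` D" using assms by (simp add: bij_betw_def)
  show "shifted_inv D A z y \<in> D" unfolding shifted_inv_def using im by (rule inv_into_into)
  show "z *\<^sub>C shifted_inv D A z y + A (shifted_inv D A z y) = y"
    unfolding shifted_inv_def using f_inv_into_f[OF im] by simp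
qed

lemma norm_orbit_generator_le_onorm:
  assumes "bounded_C0_semigroup T D (\<lambda>x. - A x) K" "t \<ge> 0" "x \<in> D"
  shows "norm (T t (A x)) \<le> onorm (\<lambda>x. T t (A (shifted_inv D A 1 x))) * norm (x + A x)"
proof -
  interpret bounded_C0_semigroup T D "\<lambda>x. - A x" K by fact
  have R: "bij_betw (\<lambda>x. 1 *\<^sub>C x + A x) D UNIV" "bounded_linear (shifted_inv D A 1)"
    by (rule shifted_inv_right_half_plane[OF assms(1)], simp)+
  have "A (shifted_inv D A 1 y) = y - shifted_inv D A 1 y" for y
    using shifted_inv_in_D(2)[OF R(1), of y] by (simp add: algebra_simps)
  then have "bounded_linear (\<lambda>x. T t (A (shifted_inv D A 1 x)))"
    using bounded_linear_compose[OF U_linear[OF assms(2)]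
        bounded_linear_sub[OF bounded_linear_ident R(2)]] by simp
  moreover have "shifted_inv D A 1 (x + A x) = x"
    unfolding shifted_inv_def using R(1) assms(3)
    by (intro inv_into_f_eq) (auto simp: bij_betw_def)
  ultimately show ?thesis using onorm[of "\<lambda>x. T t (A (shifted_inv D A 1 x))" "x + A x"] by simp
qed

section \<open>From decay of the semigroup to growth of the resolvent\<close>

text \<open>The heart of the argument. The lower bound \<open>norm_le_orbit_generator\<close> for the rotated semigroup
  reduces the claim to bounding \<open>norm (T t x)\<close>, and \<open>i s T t x = T t y - T t A x\<close> with the decay
  hypothesis does that up to a multiple of \<open>norm x\<close>. The factor \<open>1 / 4\<close> makes this multiple at most
  \<open>\<bar>s\<bar> / 2\<close>, half of the left-hand side.\<close>

lemma norm_le_imaginary_shift: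
  assumes "bounded_C0_semigroup T D (\<lambda>x. - A x) K"
    and t: "t \<ge> 0" and x: "x \<in> D" and s: "s \<noteq> 0" "\<bar>s\<bar> \<le> 1"
    and decay: "norm (T t (A x)) \<le> \<bar>s\<bar> / 4 * norm (x + A x)"
  defines "y \<equiv> (\<i> * complex_of_real s) *\<^sub>C x + A x"
  shows "norm x \<le> 2 * (K * t + (K + 1) / \<bar>s\<bar>) * norm y"
proof -
  interpret bounded_C0_semigroup T D "\<lambda>x. - A x" K by fact
  let ?z = "\<i> * complex_of_real s"
  interpret S: bounded_C0_semigroup "\<lambda>t x. exp (- (?z * complex_of_real t)) *\<^sub>C T t x" D
    "\<lambda>x. - A x - ?z *\<^sub>C x" K
    using bounded_C0_semigroup_rescale[OF assms(1), of ?z] by simp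
  have "- A x - ?z *\<^sub>C x = - y" by (simp add: y_def)
  then have 1: "norm x \<le> norm (T t x) + K * t * norm y"
    using S.norm_le_orbit_generator[OF x t] by (simp add: norm_scaleC)
  have "?z *\<^sub>C T t x = T t (?z *\<^sub>C x)"
    using C0 t by (auto simp: C0_semigroup_def bounded_clinear_def)
  also have "\<dots> = T t (y - A x)" by (simp add: y_def)
  also have "\<dots> = T t y - T t (A x)" by (rule U_diff[OF t])
  finally have "\<bar>s\<bar> * norm (T t x) = norm (T t y - T t (A x))"
    by (metis norm_scaleC norm_mult norm_ii norm_of_real mult_1 )
  also have "\<dots> \<le> K * norm y + \<bar>s\<bar> / 4 * norm (x + A x)"
    using norm_triangle_ineq4[of "T t y" "T t (A x)"] norm_le[OF t, of y] decay by linarith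
  finally have 2: "\<bar>s\<bar> * norm (T t x) \<le> K * norm y + \<bar>s\<bar> / 4 * norm (x + A x)" .
  have "x + A x = x + y - ?z *\<^sub>C x" by (simp add: y_def)
  then have "norm (x + A x) \<le> norm (x + y) + norm (?z *\<^sub>C x)"
    by (metis norm_triangle_ineq4)
  also have "\<dots> \<le> norm x + norm y + \<bar>s\<bar> * norm x"
    using norm_triangle_ineq[of x y] by (simp add: norm_scaleC norm_mult)
  also have "\<dots> \<le> 2 * norm x + norm y"
    using mult_right_mono[OF s(2), of "norm x"] by simp
  finally have "\<bar>s\<bar> / 4 * norm (x + A x) \<le> \<bar>s\<bar> / 4 * (2 * norm x + norm y)"
    by (intro mult_left_mono) auto
  moreover have "\<bar>s\<bar> / 4 * norm y \<le> norm y"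
    using s by (intro mult_left_le_one_le) auto
  ultimately have 3: "\<bar>s\<bar> * norm (T t x) \<le> (K + 1) * norm y + \<bar>s\<bar> / 2 * norm x"
    using 2 by (simp add: algebra_simps)
  have "\<bar>s\<bar> * norm x \<le> \<bar>s\<bar> * norm (T t x) + \<bar>s\<bar> * (K * t * norm y)"
    using mult_left_mono[OF 1, of "\<bar>s\<bar>"] by (simp add: algebra_simps)
  with 3 have "\<bar>s\<bar> * norm x \<le> 2 * ((K + 1) * norm y + \<bar>s\<bar> * (K * t * norm y))" by simp
  also have "\<dots> = \<bar>s\<bar> * (2 * (K * t + (K + 1) / \<bar>s\<bar>) * norm y)"
    using s by (simp add: field_simps)
  finally show ?thesis using s by simp
qed

text \<open>The boundedness hypothesis matters: the supremum of an unbounded set of reals is a default value,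
  about which nothing is known.\<close>

lemma resolvent_sup_antimono:
  assumes "bdd_above ((\<lambda>s. onorm (shifted_inv D A (\<i> * complex_of_real s))) ` {s. \<bar>s\<bar> \<ge> a})"
    and "a \<le> b"
  shows "resolvent_sup D A b \<le> resolvent_sup D A a"
  unfolding resolvent_sup_def
proof (rule cSUP_subset_mono)
  have "b \<le> \<bar>\<bar>b\<bar>\<bar>" by simp
  then show "{r. b \<le> \<bar>r\<bar>} \<noteq> {}" by blast
qed (use assms in auto)

lemma onorm_le_resolvent_sup:
  assumes "bdd_above ((\<lambda>s. onorm (shifted_inv D A (\<i> * complex_of_real s))) ` {s. \<bar>s\<bar> \<ge> a})"
    and "a \<le> \<bar>r\<bar>"
  shows "onorm (shifted_inv D A (\<i> * complex_of_real r)) \<le> resolvent_sup D A a"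
  unfolding resolvent_sup_def using assms by (intro cSUP_upper) auto

theorem corollary6p11:
  fixes T :: "real \<Rightarrow> 'a::complex_banach \<Rightarrow> 'a"
    and D :: "'a set" and A :: "'a \<Rightarrow> 'a"
    and m_inv :: "real \<Rightarrow> real"
  assumes "C0_semigroup T" and "bounded_semigroup T"
    and "is_generator T D (\<lambda>x. - A x)"
    and "spectrum D A \<inter> range (\<lambda>s. \<i> * complex_of_real s) = {0}"
    and "\<And>\<eta>. \<eta> > 0 \<Longrightarrow>
      bdd_above ((\<lambda>s. onorm (shifted_inv D A (\<i> * complex_of_real s))) ` {s. \<bar>s\<bar> \<ge> \<eta>})"
    and "filterlim
      (\<lambda>s. max (onorm (\<lambda>x. s *\<^sub>R shifted_inv D A (\<i> * complex_of_real s) x))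
                (onorm (\<lambda>x. s *\<^sub>R shifted_inv D A (- \<i> * complex_of_real s) x)))
      at_top (at 0)"
    and "\<forall>\<^sub>F t in at_top. m_inv t > 0 \<and> resolvent_sup D A (m_inv t) = t"
  shows "\<exists>c>0. \<exists>c'>0. \<forall>\<^sub>F t in at_top.
    onorm (\<lambda>x. T t (A (shifted_inv D A 1 x))) \<ge> c * m_inv (c' * t)"
proof -
  let ?R = "\<lambda>s. shifted_inv D A (\<i> * complex_of_real s)"
  let ?m = "resolvent_sup D A"
  note bdd = assms(5)
  obtain K where K: "\<And>t. t \<ge> 0 \<Longrightarrow> onorm (T t) \<le> K"
    using assms(2) by (auto simp: bounded_semigroup_def bdd_above_def)
  have lin: "bounded_linear (T t)" if "t \<ge> 0" for t
    using assms(1) that by (auto simp: C0_semigroup_def bounded_clinear_def)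
  have K0: "K \<ge> 0" using K[of 0] onorm_pos_le[OF lin[of 0]] by simp
  have S: "bounded_C0_semigroup T D (\<lambda>x. - A x) K"
  proof
    fix t :: real and x assume "t \<ge> 0"
    show "norm (T t x) \<le> K * norm x"
      using onorm[OF lin, of t x] mult_right_mono[OF K, of t "norm x"] \<open>t \<ge> 0\<close> by simp
  qed (use assms in auto)
  have res: "bij_betw (\<lambda>x. (\<i> * complex_of_real s) *\<^sub>C x + A x) D UNIV" "bounded_linear (?R s)"
    if "s \<noteq> 0" for s
  proof -
    have "- (\<i> * complex_of_real s) \<in> range (\<lambda>s. \<i> * complex_of_real s)"
      by (rule range_eqI[of _ _ "- s"]) simp
    moreover have "- (\<i> * complex_of_real s) \<noteq> 0" using that by simp
    ultimately have "- (\<i> * complex_of_real s) \<notin> spectrum D A" using assms(4) by blast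
    then have "- (\<i> * complex_of_real s) \<in> resolvent_set D A" by (simp add: spectrum_def)
    from shifted_inv_if_resolvent[OF this]
    show "bij_betw (\<lambda>x. (\<i> * complex_of_real s) *\<^sub>C x + A x) D UNIV" "bounded_linear (?R s)" .
  qed

  define C where "C = 2 * (K + 1)"
  have C: "C > 0" using K0 by (simp add: C_def)
  let ?L = "3 * C"

  \<comment> \<open>The larger of the two resolvent norms at \<open>\<plusminus>s\<close> is at most \<open>m s\<close>, so \<open>s m s\<close> tends to infinity.\<close>
  obtain \<delta> where \<delta>: "\<delta> > 0" and growth: "\<And>s. 0 < s \<Longrightarrow> s < \<delta> \<Longrightarrow> ?L \<le> s * ?m s"
  proof -
    have "\<forall>\<^sub>F s in at 0. ?L \<le> max (onorm (\<lambda>x. s *\<^sub>R ?R s x))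
        (onorm (\<lambda>x. s *\<^sub>R shifted_inv D A (- \<i> * complex_of_real s) x))"
      using assms(6) by (auto simp: filterlim_at_top)
    then obtain \<delta> where \<delta>: "\<delta> > 0" and ge: "\<And>s. s \<noteq> 0 \<Longrightarrow> \<bar>s\<bar> < \<delta> \<Longrightarrow>
        ?L \<le> max (onorm (\<lambda>x. s *\<^sub>R ?R s x))
        (onorm (\<lambda>x. s *\<^sub>R shifted_inv D A (- \<i> * complex_of_real s) x))"
      by (auto simp: eventually_at)
    have "?L \<le> s * ?m s" if s: "0 < s" "s < \<delta>" for s
    proof -
      have "onorm (\<lambda>x. s *\<^sub>R ?R r x) \<le> s * ?m s" if "\<bar>r\<bar> = s" for r
        using onorm_scaleR[OF res(2), of r s] onorm_le_resolvent_sup[OF bdd, of s r] that s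
        by (auto simp: mult_left_mono)
      from this[of s] this[of "- s"] show ?thesis using ge[of s] s by auto
    qed
    with \<delta> show ?thesis using that by blast
  qed

  have mono: "?m b \<le> ?m a" if "0 < a" "a \<le> b" for a b
    by (rule resolvent_sup_antimono[OF bdd]) (use that in auto)

  have main: "1 / 4 * s \<le> onorm (\<lambda>x. T t (A (shifted_inv D A 1 x)))"
    if t: "t > 0" "?L * t > ?m \<delta>" "?L * t > ?m 1" and s: "s > 0" "?m s = ?L * t" for t s
  proof (rule ccontr)
    let ?f = "onorm (\<lambda>x. T t (A (shifted_inv D A 1 x)))"
    assume "\<not> ?thesis"
    then have f: "?f \<le> s / 4" by simp
    \<comment> \<open>Since \<open>m\<close> decreases, the large value \<open>m s\<close> forces \<open>s\<close> into the range where \<open>growth\<close> applies.\<close>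
    have "s < \<delta>" using mono[OF \<delta>, of s] s t by fastforce
    from growth[OF s(1) this] have "1 \<le> s * t" using s C by simp
    then have inv: "1 / s \<le> t" using s by (simp add: field_simps)
    have "onorm (?R r) \<le> max (?m 1) (2 * C * t)" if r: "s \<le> \<bar>r\<bar>" for r
    proof (cases "\<bar>r\<bar> \<ge> 1")
      case True
      then show ?thesis using onorm_le_resolvent_sup[OF bdd, of 1 r] by simp
    next
      case False
      have r0: "r \<noteq> 0" using r s by auto
      have "norm (?R r y) \<le> 2 * C * t * norm y" for y
      proof -
        let ?x = "?R r y"
        note x = shifted_inv_in_D[OF res(1)[OF r0], of y]
        have "norm (T t (A ?x)) \<le> ?f * norm (?x + A ?x)"
          by (rule norm_orbit_generator_le_onorm[OF S _ x(1)]) (use t in simp)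
        also have "\<dots> \<le> \<bar>r\<bar> / 4 * norm (?x + A ?x)"
          using f r by (intro mult_right_mono) auto
        finally have "norm ?x \<le> 2 * (K * t + (K + 1) / \<bar>r\<bar>) * norm y"
          using norm_le_imaginary_shift[OF S _ x(1) r0] x(2) False t by simp
        also have "\<dots> \<le> 2 * C * t * norm y"
        proof (rule mult_right_mono)
          have "1 / \<bar>r\<bar> \<le> 1 / s" using r s by (simp add: frac_le)
          with inv have "(K + 1) * (1 / \<bar>r\<bar>) \<le> (K + 1) * t" using K0 by (intro mult_left_mono) auto
          moreover have "K * t \<le> (K + 1) * t" using t by simp
          ultimately have "K * t + (K + 1) * (1 / \<bar>r\<bar>) \<le> (K + 1) * t + (K + 1) * t"
            by (rule add_mono[rotated])
          then have "2 * (K * t + (K + 1) * (1 / \<bar>r\<bar>)) \<le> 2 * ((K + 1) * t + (K + 1) * t)"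
            by (rule mult_left_mono) simp
          also have "\<dots> = 2 * C * t" by (simp add: C_def algebra_simps)
          finally show "2 * (K * t + (K + 1) / \<bar>r\<bar>) \<le> 2 * C * t" by simp
        qed simp
        finally show ?thesis .
      qed
      then have "onorm (?R r) \<le> 2 * C * t" using C t by (intro onorm_bound) auto
      then show ?thesis by simp
    qed
    then have "?m s \<le> max (?m 1) (2 * C * t)"
      unfolding resolvent_sup_def[of D A s] using s(1)
      by (intro cSUP_least) (auto intro: exI[of _ s])
    moreover have "0 < C * t" using C t by simp
    ultimately show False using s t by auto
  qed

  have lim: "filterlim (\<lambda>t. ?L * t) at_top at_top"
    using C by (intro filterlim_tendsto_pos_mult_at_top[OF tendsto_const _ filterlim_ident]) auto
  have "\<forall>\<^sub>F t in at_top. 1 / 4 * m_inv (?L * t) \<le> onorm (\<lambda>x. T t (A (shifted_inv D A 1 x)))"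
    using eventually_gt_at_top[of "0::real"]
      eventually_compose_filterlim[OF eventually_gt_at_top[of "?m \<delta>"] lim]
      eventually_compose_filterlim[OF eventually_gt_at_top[of "?m 1"] lim]
      eventually_compose_filterlim[OF assms(7) lim]
    by eventually_elim (use main in auto)
  moreover have "?L > 0" using C by simp
  ultimately show ?thesis by (intro exI[of _ "1/4"] exI[of _ ?L] conjI) auto
qed

end
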